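(* Let $d$ be a positive integer. Then the $\mathbb{R}$-vector space $\mathbb{R}_{d-2}[X]$ is a complement subspace of $\mathscr{E}_d$ in $\mathbb{R}[X]$; that is, $$\mathscr{E}_d \oplus \mathbb{R}_{d - 2}[X] = \mathbb{R}[X] .$$ In particular, the codimension of $\mathscr{E}_d$ in $\mathbb{R}[X]$ is equal to $d - 1$.
   Context: Here $\mathbb{N} = \{0, 1, 2, \dots\}$. For $m \in \mathbb{N}$, $\mathbb{R}_m[X]$ denotes the $\mathbb{R}$-linear subspace of $\mathbb{R}[X]$ consisting of the real polynomials of degree $\leq m$, and by convention $\mathbb{R}_{-1}[X] := \{0\}$. For a positive integer $d$, $\mathscr{E}_d$ denotes the set (an $\mathbb{R}$-linear subspace of $\mathbb{R}[X]$) of all polynomials $P \in \mathbb{R}[X]$ for which the sum $P(n) + P(n-d) + P(n-2d) + \cdots := \sum_{0 \leq k \leq n/d} P(n - k d)$ (the sum over integers $k \ge 0$ with $n - kd \geq 0$) is polynomial in $n \in \mathbb{N}$, i.e. there exists $S \in \mathbb{R}[X]$ such that this sum equals $S(n)$ for all $n \in \mathbb{N}$. *)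

theory Defs
  imports "HOL-Algebra.AbelCoset" "Jordan_Normal_Form.VS_Connect"
begin

text \<open>The polynomials over the reals as a vector space record over \<open>class_ring :: real ring\<close>,
  in the sense of the locale \<open>vectorspace\<close>.\<close>

definition real_poly_space :: "(real, real poly) module" where
  "real_poly_space =
     \<lparr>carrier = UNIV, mult = (*), one = 1, zero = 0, add = (+), smult = Polynomial.smult\<rparr>"

text \<open>The bound is an integer so that \<open>-1\<close> is available. As \<open>degree 0 = 0\<close> in the library, the
  zero polynomial is listed separately; for \<open>m = -1\<close> the set is \<open>{0}\<close>.\<close>

definition polys_degree_le :: "int \<Rightarrow> real poly set" where
  "polys_degree_le m = {P. P = 0 \<or> int (degree P) \<le> m}"

text \<open>For \<open>d > 0\<close> the index set of the sum is finite. (For \<open>d = 0\<close>, which is never used, it is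
  infinite and the sum is \<open>0\<close> by convention.)\<close>

definition poly_sum_space :: "nat \<Rightarrow> real poly set" where
  "poly_sum_space d =
     {P. \<exists>S :: real poly. \<forall>n :: nat.
           (\<Sum>k | k * d \<le> n. poly P (real n - real k * real d)) = poly S (real n)}"

definition complement_subspaces ::
    "('a, 'k) ring_scheme \<Rightarrow> ('a, 'c, 'v) module_scheme \<Rightarrow> 'c set \<Rightarrow> 'c set \<Rightarrow> bool" where
  "complement_subspaces K V U W \<longleftrightarrow>
     VectorSpace.subspace K U V \<and> VectorSpace.subspace K W V \<and>
     module.submodule_sum V U W = carrier V \<and> U \<inter> W = {\<zero>\<^bsub>V\<^esub>}"

text \<open>The quotient of \<open>V\<close> by a subspace \<open>W\<close>: its vectors are the cosets of \<open>W\<close>. Scalar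
  multiplication adds \<open>W\<close> again, so that \<open>0\<close> times a coset is \<open>W\<close> and not \<open>{0}\<close>.
  The ring fields \<open>mult\<close> and \<open>one\<close> of the record play no role.\<close>

definition quotient_space ::
    "('a, 'c, 'v) module_scheme \<Rightarrow> 'c set \<Rightarrow> ('a, 'c set) module" where
  "quotient_space V W =
     \<lparr>carrier = a_rcosets\<^bsub>V\<^esub> W, mult = (\<lambda>_ _. W), one = W, zero = W,
      add = (\<lambda>A B. A <+>\<^bsub>V\<^esub> B), smult = (\<lambda>c A. \<Union>x\<in>A. W +>\<^bsub>V\<^esub> (c \<odot>\<^bsub>V\<^esub> x))\<rparr>"

text \<open>Finite-dimensionality is demanded explicitly since the library's \<open>dim\<close> is
  unspecified on spaces without a finite generating set.\<close>

definition has_codimension ::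
    "('a, 'k) ring_scheme \<Rightarrow> ('a, 'c, 'v) module_scheme \<Rightarrow> 'c set \<Rightarrow> nat \<Rightarrow> bool" where
  "has_codimension K V W n \<longleftrightarrow>
     vectorspace.fin_dim K (quotient_space V W) \<and> vectorspace.dim K (quotient_space V W) = n"

lemma vectorspace_real_poly_space: "vectorspace class_ring real_poly_space"
proof (rule vs_criteria)
  show "field (class_ring :: real ring)" by (rule class_field)
  show "\<forall>v\<in>carrier real_poly_space. \<exists>neg_v\<in>carrier real_poly_space.
          v \<oplus>\<^bsub>real_poly_space\<^esub> neg_v = \<zero>\<^bsub>real_poly_space\<^esub>"
    by (auto simp: real_poly_space_def intro: exI[of _ "- v" for v] add.right_inverse)
qed (auto simp: real_poly_space_def algebra_simps smult_add_left smult_add_right)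

lemma vectorspace_quotient_space:
  assumes "VectorSpace.subspace K W V"
  shows "vectorspace K (quotient_space V W)"
proof -
  from assms have vs: "vectorspace K V" and sm: "submodule K W V"
    by (auto simp: VectorSpace.subspace_def)
  interpret V: vectorspace K V by fact
  interpret W: submodule K W V by fact
  have neg: "\<ominus>\<^bsub>V\<^esub> w \<in> W" if "w \<in> W" for w
  proof -
    have "\<ominus>\<^bsub>K\<^esub> \<one>\<^bsub>K\<^esub> \<odot>\<^bsub>V\<^esub> w \<in> W" using that by (intro W.smult_closed) auto
    with that W.subset show ?thesis by (metis V.smult_minus_1 subsetD)
  qed
  have "subgroup W (add_monoid V)"
    using neg W.subset by (unfold_locales) (auto simp: a_inv_def)
  then have "abelian_subgroup W V"
    by (intro abelian_subgroupI3) (auto intro: additive_subgroup.intro V.abelian_group_axioms)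
  then interpret S: abelian_subgroup W V .
  have cos: "\<exists>x\<in>carrier V. A = W +>\<^bsub>V\<^esub> x" if "A \<in> a_rcosets\<^bsub>V\<^esub> W" for A
    using that by (auto simp: A_RCOSETS_def')
  have mem: "W +>\<^bsub>V\<^esub> x \<in> a_rcosets\<^bsub>V\<^esub> W" if "x \<in> carrier V" for x
    using that by (auto simp: A_RCOSETS_def')
  have add: "(W +>\<^bsub>V\<^esub> x) <+>\<^bsub>V\<^esub> (W +>\<^bsub>V\<^esub> y) = W +>\<^bsub>V\<^esub> (x \<oplus>\<^bsub>V\<^esub> y)"
    if "x \<in> carrier V" "y \<in> carrier V" for x y
    using that by (rule S.a_rcos_sum)
  have sm: "(\<Union>y\<in>W +>\<^bsub>V\<^esub> x. W +>\<^bsub>V\<^esub> (c \<odot>\<^bsub>V\<^esub> y)) = W +>\<^bsub>V\<^esub> (c \<odot>\<^bsub>V\<^esub> x)"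
    if c: "c \<in> carrier K" and x: "x \<in> carrier V" for c x
  proof -
    have "W +>\<^bsub>V\<^esub> (c \<odot>\<^bsub>V\<^esub> y) = W +>\<^bsub>V\<^esub> (c \<odot>\<^bsub>V\<^esub> x)" if y: "y \<in> W +>\<^bsub>V\<^esub> x" for y
    proof -
      from y obtain w where w: "w \<in> W" "y = w \<oplus>\<^bsub>V\<^esub> x" by (auto simp: a_r_coset_def')
      then have wV: "w \<in> carrier V" using W.subset by auto
      have cw: "c \<odot>\<^bsub>V\<^esub> w \<in> W" using c w by auto
      have "W +>\<^bsub>V\<^esub> (c \<odot>\<^bsub>V\<^esub> y) = W +>\<^bsub>V\<^esub> (c \<odot>\<^bsub>V\<^esub> w \<oplus>\<^bsub>V\<^esub> c \<odot>\<^bsub>V\<^esub> x)"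
        using w wV c x by (simp add: V.smult_r_distr)
      also have "\<dots> = (W +>\<^bsub>V\<^esub> (c \<odot>\<^bsub>V\<^esub> w)) +>\<^bsub>V\<^esub> (c \<odot>\<^bsub>V\<^esub> x)"
        using wV c x W.subset by (simp add: V.a_coset_add_assoc)
      also have "W +>\<^bsub>V\<^esub> (c \<odot>\<^bsub>V\<^esub> w) = W"
        using cw by (rule S.a_rcos_const)
      finally show ?thesis .
    qed
    moreover have "x \<in> W +>\<^bsub>V\<^esub> x" using x by (rule S.a_rcos_self)
    ultimately show ?thesis by blast
  qed
  have W0: "W +>\<^bsub>V\<^esub> \<zero>\<^bsub>V\<^esub> = W" using W.zero_closed by (rule S.a_rcos_const)
  have W0': "W \<in> a_rcosets\<^bsub>V\<^esub> W" using mem[of "\<zero>\<^bsub>V\<^esub>"] W0 by simp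
  let ?Q = "quotient_space V W"
  have car: "carrier ?Q = (\<lambda>x. W +>\<^bsub>V\<^esub> x) ` carrier V"
    by (auto simp: quotient_space_def A_RCOSETS_def')
  have addQ: "(W +>\<^bsub>V\<^esub> x) \<oplus>\<^bsub>?Q\<^esub> (W +>\<^bsub>V\<^esub> y) = W +>\<^bsub>V\<^esub> (x \<oplus>\<^bsub>V\<^esub> y)"
    if "x \<in> carrier V" "y \<in> carrier V" for x y
    using add that by (simp add: quotient_space_def)
  have smQ: "c \<odot>\<^bsub>?Q\<^esub> (W +>\<^bsub>V\<^esub> x) = W +>\<^bsub>V\<^esub> (c \<odot>\<^bsub>V\<^esub> x)"
    if "c \<in> carrier K" "x \<in> carrier V" for c x
    using sm that by (simp add: quotient_space_def)
  have zeroQ: "\<zero>\<^bsub>?Q\<^esub> = W +>\<^bsub>V\<^esub> \<zero>\<^bsub>V\<^esub>" using W0 by (simp add: quotient_space_def)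
  show ?thesis
  proof (rule vs_criteria)
    show "field K" ..
    show "\<forall>v\<in>carrier ?Q. \<exists>neg_v\<in>carrier ?Q. v \<oplus>\<^bsub>?Q\<^esub> neg_v = \<zero>\<^bsub>?Q\<^esub>"
    proof
      fix v assume "v \<in> carrier ?Q"
      then obtain x where x: "x \<in> carrier V" "v = W +>\<^bsub>V\<^esub> x" by (auto simp: car)
      then show "\<exists>neg_v\<in>carrier ?Q. v \<oplus>\<^bsub>?Q\<^esub> neg_v = \<zero>\<^bsub>?Q\<^esub>"
        by (intro bexI[of _ "W +>\<^bsub>V\<^esub> (\<ominus>\<^bsub>V\<^esub> x)"]) (auto simp: car addQ zeroQ V.M.r_neg)
    qed
  qed (auto simp: car addQ smQ zeroQ V.M.a_ac V.smult_assoc1 V.smult_l_distr V.smult_r_distr)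
qed

end

theory Submission
  imports Defs
begin

text \<open>Comparing the sums at \<open>n\<close> and \<open>n - d\<close> shows that \<open>P \<in> \<E>\<^sub>d\<close> iff
  \<open>P(X) = S(X) - S(X - d)\<close> for some \<open>S\<close> vanishing at \<open>-1, \<dots>, -d\<close>. A nonzero such \<open>S\<close> has degree
  at least \<open>d\<close>, and the backward difference lowers the degree by exactly one; so the nonzero
  elements of \<open>\<E>\<^sub>d\<close> have degree at least \<open>d - 1\<close>, and every such degree occurs. Hence \<open>\<E>\<^sub>d\<close> meets
  the polynomials of degree at most \<open>d - 2\<close> trivially, and cancelling leading terms one at a
  time shows that the two together span everything.\<close>

section \<open>Quotients by a complemented subspace\<close>

lemma linear_mapI:
  assumes "vectorspace K V" "vectorspace K W" "f \<in> LinearCombinations.module_hom K V W"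
  shows "linear_map K V W f"
  using assms
  by (auto simp: linear_map_def mod_hom_def mod_hom_axioms_def vectorspace_def)

text \<open>Negatives stay in \<open>U\<close> because they are multiples by \<open>-1\<close>. This
  opens the coset calculus of additive subgroups to subspaces.\<close>

lemma abelian_subgroup_if_subspace:
  assumes "VectorSpace.subspace K U V"
  shows "abelian_subgroup U V"
proof -
  from assms have vs: "vectorspace K V" and sm: "submodule K U V"
    by (auto simp: VectorSpace.subspace_def)
  interpret V: vectorspace K V by fact
  interpret U: submodule K U V by fact
  have "\<ominus>\<^bsub>V\<^esub> u \<in> U" if "u \<in> U" for u
  proof -
    have "\<ominus>\<^bsub>K\<^esub> \<one>\<^bsub>K\<^esub> \<odot>\<^bsub>V\<^esub> u \<in> U" using that by (intro U.smult_closed) auto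
    with that U.subset show ?thesis by (metis V.smult_minus_1 subsetD)
  qed
  then have "subgroup U (add_monoid V)"
    using U.subset by (unfold_locales) (auto simp: a_inv_def)
  then show ?thesis
    by (intro abelian_subgroupI3) (auto intro: additive_subgroup.intro V.abelian_group_axioms)
qed

lemma linear_map_quotient_projection:
  assumes U: "VectorSpace.subspace K U V"
  shows "linear_map K V (quotient_space V U) (\<lambda>x. U +>\<^bsub>V\<^esub> x)"
proof -
  from U have vs: "vectorspace K V" and sm: "submodule K U V"
    by (auto simp: VectorSpace.subspace_def)
  interpret V: vectorspace K V by fact
  interpret U: submodule K U V by fact
  interpret Q: vectorspace K "quotient_space V U"
    by (rule vectorspace_quotient_space[OF U])
  interpret S: abelian_subgroup U V
    by (rule abelian_subgroup_if_subspace[OF U])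
  have smult: "(\<Union>y\<in>U +>\<^bsub>V\<^esub> x. U +>\<^bsub>V\<^esub> (c \<odot>\<^bsub>V\<^esub> y)) = U +>\<^bsub>V\<^esub> (c \<odot>\<^bsub>V\<^esub> x)"
    if c: "c \<in> carrier K" and x: "x \<in> carrier V" for c x
  proof -
    \<comment> \<open>Two representatives differ by an element of \<open>U\<close>, and so do their
      multiples by \<open>c\<close>. Hence the union defining scalar multiplication is over copies
      of a single coset.\<close>
    have "U +>\<^bsub>V\<^esub> (c \<odot>\<^bsub>V\<^esub> x) = U +>\<^bsub>V\<^esub> (c \<odot>\<^bsub>V\<^esub> y)" if y: "y \<in> U +>\<^bsub>V\<^esub> x" for y
    proof (rule S.a_repr_independence')
      from y obtain u where u: "u \<in> U" "y = u \<oplus>\<^bsub>V\<^esub> x" by (auto simp: a_r_coset_def')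
      moreover have "u \<in> carrier V" using u U.subset by auto
      ultimately have "c \<odot>\<^bsub>V\<^esub> y = c \<odot>\<^bsub>V\<^esub> u \<oplus>\<^bsub>V\<^esub> c \<odot>\<^bsub>V\<^esub> x"
        using c x by (simp add: V.smult_r_distr)
      then show "c \<odot>\<^bsub>V\<^esub> y \<in> U +>\<^bsub>V\<^esub> (c \<odot>\<^bsub>V\<^esub> x)"
        using u c by (auto simp: a_r_coset_def')
      show "c \<odot>\<^bsub>V\<^esub> x \<in> carrier V" using c x by simp
    qed
    moreover have "x \<in> U +>\<^bsub>V\<^esub> x" using x by (rule S.a_rcos_self)
    ultimately show ?thesis by blast
  qed
  have "(\<lambda>x. U +>\<^bsub>V\<^esub> x) \<in> LinearCombinations.module_hom K V (quotient_space V U)"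
    by (auto simp: LinearCombinations.module_hom_def quotient_space_def A_RCOSETS_def' S.a_rcos_sum smult)
  then show ?thesis
    by (intro linear_mapI V.vectorspace_axioms Q.vectorspace_axioms)
qed

text \<open>The composite of \<open>f\<close> with the projection to the quotient is an isomorphism:
  injective since the image of \<open>f\<close> meets \<open>U\<close> only in zero, surjective
  since the two span \<open>V\<close>. Parametrizing the complement by \<open>Z\<close> lets the
  codimension be read off from a space of known dimension.\<close>

lemma has_codimension_if_complement_is_image:
  assumes f: "linear_map K Z V f" and fin: "vectorspace.fin_dim K Z"
    and inj: "inj_on f (carrier Z)"
    and compl: "complement_subspaces K V U (f ` carrier Z)"
  shows "has_codimension K V U (vectorspace.dim K Z)"
proof -
  have U: "VectorSpace.subspace K U V"
    using compl by (auto simp: complement_subspaces_def)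
  interpret V: vectorspace K V using U by (auto simp: VectorSpace.subspace_def)
  interpret Z: vectorspace K Z using f by (simp add: linear_map_def)
  interpret f: linear_map K Z V f by fact
  interpret U: submodule K U V using U by (auto simp: VectorSpace.subspace_def)
  interpret p: linear_map K V "quotient_space V U" "\<lambda>x. U +>\<^bsub>V\<^esub> x"
    by (rule linear_map_quotient_projection[OF U])
  interpret S: abelian_subgroup U V
    by (rule abelian_subgroup_if_subspace[OF U])
  have sum: "V.submodule_sum U (f ` carrier Z) = carrier V"
    and int: "U \<inter> f ` carrier Z = {\<zero>\<^bsub>V\<^esub>}"
    using compl by (auto simp: complement_subspaces_def)
  let ?g = "\<lambda>z. U +>\<^bsub>V\<^esub> f z"
  have "?g \<in> LinearCombinations.module_hom K Z (quotient_space V U)"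
    using p.f_add p.f_smult p.f_im by (auto simp: LinearCombinations.module_hom_def)
  then interpret g: linear_map K Z "quotient_space V U" ?g
    by (intro linear_mapI Z.vectorspace_axioms p.W.vectorspace_axioms)
  have inj_g: "inj_on ?g (carrier Z)"
  proof (rule inj_onI)
    fix x y assume x: "x \<in> carrier Z" and y: "y \<in> carrier Z" and eq: "?g x = ?g y"
    have "f x \<in> U +>\<^bsub>V\<^esub> f y"
      using S.a_rcos_self[of "f x"] x eq by simp
    then obtain u where u: "u \<in> U" "f x = u \<oplus>\<^bsub>V\<^esub> f y" by (auto simp: a_r_coset_def')
    then have uV: "u \<in> carrier V" using U.subset by auto
    \<comment> \<open>The difference of the two images lies both in \<open>U\<close> and in the
      image of \<open>f\<close>, so it vanishes.\<close>
    have "f (x \<ominus>\<^bsub>Z\<^esub> y) = f x \<ominus>\<^bsub>V\<^esub> f y" using x y by simp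
    also have "\<dots> = u"
      using u uV y by (simp add: a_minus_def V.M.a_assoc V.M.r_neg)
    finally have "u \<in> U \<inter> f ` carrier Z"
      using u x y by (metis IntI Z.M.minus_closed imageI)
    then have "u = \<zero>\<^bsub>V\<^esub>" using int by blast
    then have "f x = f y" using u y by simp
    then show "x = y" using inj x y by (auto dest: inj_onD)
  qed
  have surj_g: "?g ` carrier Z = carrier (quotient_space V U)"
  proof (intro subset_antisym subsetI)
    fix A assume "A \<in> carrier (quotient_space V U)"
    then obtain v where v: "v \<in> carrier V" "A = U +>\<^bsub>V\<^esub> v"
      by (auto simp: quotient_space_def A_RCOSETS_def')
    from v(1) obtain u z where u: "u \<in> U" "z \<in> carrier Z" "v = u \<oplus>\<^bsub>V\<^esub> f z"
      unfolding sum[symmetric] V.submodule_sum_def by auto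
    then have "v \<in> U +>\<^bsub>V\<^esub> f z" by (auto simp: a_r_coset_def')
    then have "U +>\<^bsub>V\<^esub> f z = A"
      unfolding v using u by (intro S.a_repr_independence') auto
    then show "A \<in> ?g ` carrier Z" using u by blast
  qed (use g.f_im in blast)
  show ?thesis
    unfolding has_codimension_def
    using g.surj_fin_dim[OF fin surj_g] g.dim_eq[OF fin inj_g surj_g] by simp
qed

section \<open>Backward differences of polynomials\<close>

definition backward_diff :: "'a \<Rightarrow> 'a poly \<Rightarrow> 'a::comm_ring_1 poly" where
  "backward_diff h p = p - pcompose p [:-h, 1:]"

lemma poly_backward_diff: "poly (backward_diff h p) x = poly p x - poly p (x - h)"
  by (simp add: backward_diff_def poly_pcompose)

text \<open>A product rule for multiplication by \<open>X\<close>: the difference of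
  \<open>X p\<close> is \<open>X\<close> times that of \<open>p\<close>, plus
  \<open>h p(X - h)\<close>, and the constant \<open>a\<close> drops out. It drives the inductions
  below.\<close>

lemma backward_diff_pCons:
  "backward_diff h (pCons a p) =
     pCons 0 (backward_diff h p) + Polynomial.smult h (pcompose p [:-h, 1:])"
  by (simp add: backward_diff_def pcompose_pCons algebra_simps)

text \<open>A shift of the argument preserves the top coefficient, so the terms in
  \<open>X^m\<close> cancel. Bounding by vanishing coefficients instead of \<open>degree\<close>
  lets the hypothesis pass directly to the tail of the coefficient list.\<close>

lemma coeff_backward_diff:
  assumes "\<And>j. j > m \<Longrightarrow> coeff p j = 0" "i \<ge> m"
  shows "coeff (backward_diff h p) i = 0"
  using assms
proof (induction p arbitrary: m i)
  case 0
  then show ?case by (simp add: backward_diff_def)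
next
  case (pCons a p)
  show ?case
  proof (cases m)
    case 0
    then have "p = 0"
      using pCons.prems(1)[of "Suc _"] by (intro poly_eqI) simp
    then show ?thesis by (simp add: backward_diff_def)
  next
    case (Suc m')
    then obtain i' where i': "i = Suc i'" "i' \<ge> m'" using pCons.prems by (cases i) auto
    have p: "coeff p j = 0" if "j > m'" for j
      using pCons.prems(1)[of "Suc j"] that Suc by simp
    have "coeff (backward_diff h p) k = 0" if "k \<ge> m'" for k
      using pCons.IH[OF p that] by simp
    then have "coeff (backward_diff h p) i' = 0" "coeff (backward_diff h p) i = 0"
      using i' by auto
    \<comment> \<open>Writing the shift as \<open>p\<close> minus its difference brings the second
      summand under the induction hypothesis too.\<close>
    moreover have "coeff (pcompose p [:-h, 1:]) i = coeff p i - coeff (backward_diff h p) i"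
      by (simp add: backward_diff_def)
    moreover have "coeff p i = 0" using p i' by simp
    ultimately show ?thesis by (simp add: backward_diff_pCons i')
  qed
qed

text \<open>Truncated subtraction is harmless: a constant has difference zero, whose
  \<open>degree\<close> is \<open>0\<close>.\<close>

lemma degree_backward_diff: "degree (backward_diff h p) \<le> degree p - 1"
proof (cases "degree p")
  case 0
  then show ?thesis by (auto elim: degree_eq_zeroE simp: backward_diff_def)
next
  case (Suc n)
  have "coeff (backward_diff h p) i = 0" if "i > n" for i
    by (rule coeff_backward_diff[where m = "Suc n"]) (use that Suc in \<open>auto simp: coeff_eq_0\<close>)
  then show ?thesis using Suc by (auto intro: degree_le)
qed

text \<open>In the product rule, the difference of the tail contributes \<open>m * h\<close> and the
  shifted tail, whose top coefficient is unchanged, contributes one more \<open>h\<close>.\<close>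

lemma coeff_backward_diff_top:
  assumes "\<And>j. j > Suc m \<Longrightarrow> coeff p j = 0"
  shows "coeff (backward_diff h p) m = of_nat (Suc m) * h * coeff p (Suc m)"
  using assms
proof (induction p arbitrary: m)
  case 0
  then show ?case by (simp add: backward_diff_def)
next
  case (pCons a p)
  have p: "coeff p j = 0" if "j > m" for j
    using pCons.prems[of "Suc j"] that by simp
  have "coeff (pcompose p [:-h, 1:]) m = coeff p m - coeff (backward_diff h p) m"
    by (simp add: backward_diff_def)
  also have "coeff (backward_diff h p) m = 0"
    by (rule coeff_backward_diff[where m = m]) (use p in auto)
  finally have *: "coeff (pcompose p [:-h, 1:]) m = coeff p m" by simp
  show ?case
  proof (cases m)
    case 0
    then show ?thesis using * by (simp add: backward_diff_pCons)
  next
    case (Suc m')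
    have "coeff (backward_diff h p) m' = of_nat (Suc m') * h * coeff p (Suc m')"
      using p Suc by (intro pCons.IH) simp
    then show ?thesis using * Suc by (simp add: backward_diff_pCons algebra_simps)
  qed
qed

section \<open>The space of polynomials with polynomial sums\<close>

text \<open>Otherwise the nonzero difference would have infinitely many roots, the naturals being
  distinct in characteristic zero.\<close>

lemma poly_eqI_nat:
  fixes p q :: "'a::{idom, ring_char_0} poly"
  assumes "\<And>n. poly p (of_nat n) = poly q (of_nat n)"
  shows "p = q"
proof (rule ccontr)
  assume "p \<noteq> q"
  then have "finite {x. poly (p - q) x = 0}" by (intro poly_roots_finite) simp
  moreover have "range of_nat \<subseteq> {x. poly (p - q) x = 0}" using assms by auto
  ultimately have "finite (range (of_nat :: nat \<Rightarrow> 'a))" by (rule rev_finite_subset)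
  moreover have "inj (of_nat :: nat \<Rightarrow> 'a)" by (simp add: inj_on_def)
  ultimately show False by (metis range_inj_infinite)
qed

lemma poly_sum_space_iff:
  assumes d: "d > 0"
  shows "P \<in> poly_sum_space d \<longleftrightarrow>
    (\<exists>S. (\<forall>j\<in>{1..d}. poly S (- real j) = 0) \<and> P = backward_diff (real d) S)"
    (is "_ \<longleftrightarrow> ?R")
proof -
  have set_eq: "{k. k * d \<le> n} = {..n div d}" for n
    using d by (auto simp: less_eq_div_iff_mult_less_eq)
  show ?thesis
  proof
    assume "P \<in> poly_sum_space d"
    then obtain S where S: "\<And>n. (\<Sum>k\<le>n div d. poly P (real n - real k * real d)) = poly S (real n)"
      by (auto simp: poly_sum_space_def set_eq)
    \<comment> \<open>The sum at \<open>n + d\<close> is the sum at \<open>n\<close> with one new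
      term in front.\<close>
    have step: "poly S (real n + real d) = poly P (real n + real d) + poly S (real n)" for n
    proof -
      have "(n + d) div d = Suc (n div d)" using d by simp
      then have "poly S (real (n + d)) =
          (\<Sum>k\<le>Suc (n div d). poly P (real (n + d) - real k * real d))"
        using S[of "n + d"] by simp
      also have "\<dots> = poly P (real (n + d)) +
          (\<Sum>k\<le>n div d. poly P (real n - real k * real d))"
        by (simp add: sum.atMost_Suc_shift algebra_simps del: sum.atMost_Suc)
      finally show ?thesis using S[of n] by simp
    qed
    \<comment> \<open>The recurrence is known only at arguments \<open>n + d\<close>, hence the
      shift by \<open>d\<close> before comparing on the naturals; it is undone afterwards.\<close>
    have "pcompose P [:real d, 1:] = pcompose (backward_diff (real d) S) [:real d, 1:]"
      by (rule poly_eqI_nat) (simp add: poly_pcompose poly_backward_diff step add.commute)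
    then have "poly (pcompose P [:real d, 1:]) (x - real d) =
        poly (pcompose (backward_diff (real d) S) [:real d, 1:]) (x - real d)" for x
      by simp
    then have "poly P x = poly (backward_diff (real d) S) x" for x
      by (simp add: poly_pcompose)
    then have P: "P = backward_diff (real d) S" by (simp add: poly_eq_poly_eq_iff[symmetric] ext)
    moreover have "poly S (- real j) = 0" if j: "j \<in> {1..d}" for j
    proof -
      \<comment> \<open>Since \<open>d - j < d\<close>, the sum at \<open>d - j\<close> has only the
        term \<open>k = 0\<close>. Combined with the difference equation this forces the root
        \<open>-j\<close>.\<close>
      have "poly P (real (d - j)) = poly S (real (d - j))"
        using S[of "d - j"] j by simp
      then show ?thesis using j unfolding P poly_backward_diff by (simp add: of_nat_diff)
    qed
    ultimately show ?R
      by blast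
  next
    assume ?R
    then obtain S where S: "\<And>j. j \<in> {1..d} \<Longrightarrow> poly S (- real j) = 0"
      and P: "P = backward_diff (real d) S" by blast
    have "(\<Sum>k\<le>n div d. poly P (real n - real k * real d)) = poly S (real n)" for n
    proof -
      have "(\<Sum>k\<le>m. poly P (real n - real k * real d)) =
          poly S (real n) - poly S (real n - real (Suc m) * real d)" for m
        by (induction m) (simp_all add: P poly_backward_diff algebra_simps)
      \<comment> \<open>Telescoping stops one step below zero, at \<open>n mod d - d\<close>, which
        is one of the prescribed roots \<open>-1, ..., -d\<close>.\<close>
      moreover have "real n - real (Suc (n div d)) * real d = - real (d - n mod d)"
      proof -
        have "real n = real (n div d) * real d + real (n mod d)"
          by (metis div_mult_mod_eq of_nat_add of_nat_mult)
        then show ?thesis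
          using d by (simp add: of_nat_diff less_imp_le algebra_simps)
      qed
      moreover have "poly S (- real (d - n mod d)) = 0"
        using d by (intro S) (auto simp: Suc_le_eq)
      ultimately show ?thesis by simp
    qed
    then show "P \<in> poly_sum_space d" by (auto simp: poly_sum_space_def set_eq)
  qed
qed

section \<open>Degrees of polynomials with polynomial sums\<close>

lemma degree_poly_sum_space:
  assumes d: "d > 0" and P: "P \<in> poly_sum_space d" "P \<noteq> 0"
  shows "d - 1 \<le> degree P"
proof -
  obtain S where roots: "\<And>j. j \<in> {1..d} \<Longrightarrow> poly S (- real j) = 0"
    and PS: "P = backward_diff (real d) S"
    using P(1) poly_sum_space_iff[OF d] by blast
  have "S \<noteq> 0" using PS P(2) by (auto simp: backward_diff_def)
  have "d = card ((\<lambda>j. - real j) ` {1..d})"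
    by (subst card_image) (auto simp: inj_on_def)
  also have "\<dots> \<le> card {x. poly S x = 0}"
    using roots \<open>S \<noteq> 0\<close> by (intro card_mono poly_roots_finite) auto
  also have "\<dots> \<le> degree S" using \<open>S \<noteq> 0\<close> by (rule card_poly_roots_bound)
  finally have "d \<le> degree S" .
  then obtain m where m: "degree S = Suc m" using d by (cases "degree S") auto
  \<comment> \<open>The factor \<open>(m + 1) d\<close> is nonzero, so the difference loses exactly
    one degree.\<close>
  have "coeff P m = real (Suc m) * real d * lead_coeff S"
    unfolding PS m by (rule coeff_backward_diff_top) (simp add: coeff_eq_0 m)
  then have "coeff P m \<noteq> 0" using d \<open>S \<noteq> 0\<close> by auto
  then have "m \<le> degree P" by (rule le_degree)
  then show ?thesis using \<open>d \<le> degree S\<close> m by simp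
qed

lemma ex_poly_sum_space_degree:
  assumes d: "d > 0" and n: "d - 1 \<le> n"
  obtains P where "P \<in> poly_sum_space d" "degree P \<le> n" "coeff P n \<noteq> 0"
proof -
  \<comment> \<open>The product supplies the required roots; the power of \<open>X\<close> raises
    the degree to \<open>n + 1\<close>, one above the target.\<close>
  define S where "S = (\<Prod>j\<in>{1..d}. [:real j, 1:]) * Polynomial.monom 1 (Suc n - d)"
  have "degree (\<Prod>j\<in>{1..d}. [:real j, 1:]) = d"
    by (subst degree_prod_eq_sum_degree) auto
  moreover have nz: "(\<Prod>j\<in>{1..d}. [:real j, 1:]) \<noteq> 0" by auto
  ultimately have deg: "degree S = Suc n"
    using d n by (simp add: S_def degree_mult_eq degree_monom_eq monom_eq_0_iff)
  let ?P = "backward_diff (real d) S"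
  have "?P \<in> poly_sum_space d"
    unfolding poly_sum_space_iff[OF d] by (rule exI[of _ S]) (auto simp: S_def poly_prod)
  moreover have "degree ?P \<le> n" using degree_backward_diff[of "real d" S] deg by simp
  moreover have "coeff ?P n = real (Suc n) * real d * coeff S (Suc n)"
    by (rule coeff_backward_diff_top) (simp add: coeff_eq_0 deg)
  then have "coeff ?P n \<noteq> 0"
    using d deg by (metis degree_0 leading_coeff_0_iff mult_eq_0_iff nat.distinct(1)
        of_nat_eq_0_iff less_not_refl)
  ultimately show ?thesis by (rule that)
qed

section \<open>Subspaces and the direct sum decomposition\<close>

lemma subspace_real_poly_spaceI:
  assumes "0 \<in> A" "\<And>p q. p \<in> A \<Longrightarrow> q \<in> A \<Longrightarrow> p + q \<in> A"
    and "\<And>c p. p \<in> A \<Longrightarrow> Polynomial.smult c p \<in> A"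
  shows "VectorSpace.subspace class_ring A real_poly_space"
proof -
  interpret vectorspace class_ring real_poly_space by (rule vectorspace_real_poly_space)
  show ?thesis
    unfolding VectorSpace.subspace_def submodule_def
    using assms vectorspace_axioms module_axioms by (auto simp: real_poly_space_def)
qed

lemma subspace_poly_sum_space: "VectorSpace.subspace class_ring (poly_sum_space d) real_poly_space"
proof (rule subspace_real_poly_spaceI)
  show "0 \<in> poly_sum_space d" by (auto simp: poly_sum_space_def intro: exI[of _ 0])
next
  fix p q assume "p \<in> poly_sum_space d" "q \<in> poly_sum_space d"
  then show "p + q \<in> poly_sum_space d"
    unfolding poly_sum_space_def by (auto simp: sum.distrib) (metis poly_add)
next
  fix c p assume "p \<in> poly_sum_space d"
  then show "Polynomial.smult c p \<in> poly_sum_space d"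
    unfolding poly_sum_space_def by (auto simp flip: sum_distrib_left) (metis poly_smult)
qed

lemma subspace_polys_degree_le:
  "VectorSpace.subspace class_ring (polys_degree_le m) real_poly_space"
proof (rule subspace_real_poly_spaceI)
  fix p q assume "p \<in> polys_degree_le m" "q \<in> polys_degree_le m"
  moreover have "degree (p + q) \<le> max (degree p) (degree q)" by (rule degree_add_le_max)
  ultimately show "p + q \<in> polys_degree_le m" by (auto simp: polys_degree_le_def)
qed (auto simp: polys_degree_le_def)

lemma poly_sum_space_plus_low_degree:
  assumes d: "d > 0"
  shows "\<exists>Q\<in>poly_sum_space d. \<exists>R\<in>polys_degree_le (int d - 2). P = Q + R"
proof -
  interpret E: submodule class_ring "poly_sum_space d" real_poly_space
    using subspace_poly_sum_space by (auto simp: VectorSpace.subspace_def)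
  have add: "p + q \<in> poly_sum_space d" if "p \<in> poly_sum_space d" "q \<in> poly_sum_space d" for p q
    using E.m_closed[OF that] by (simp add: real_poly_space_def)
  have smult: "Polynomial.smult c p \<in> poly_sum_space d" if "p \<in> poly_sum_space d" for c p
    using E.smult_closed[OF _ that] by (simp add: real_poly_space_def)
  have zero: "0 \<in> poly_sum_space d" using E.zero_closed by (simp add: real_poly_space_def)
  show ?thesis
  proof (induction "degree P" arbitrary: P rule: less_induct)
    case less
    show ?case
    proof (cases "P \<in> polys_degree_le (int d - 2)")
      case True
      then show ?thesis using zero by (intro bexI[of _ 0] bexI[of _ P]) auto
    next
      case False
      then have "d - 1 \<le> degree P" by (auto simp: polys_degree_le_def)
      then obtain T where T: "T \<in> poly_sum_space d" "degree T \<le> degree P" "coeff T (degree P) \<noteq> 0"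
        using ex_poly_sum_space_degree[OF d] by metis
      \<comment> \<open>This multiple of \<open>T\<close> cancels the leading term of
        \<open>P\<close>.\<close>
      define c where "c = lead_coeff P / coeff T (degree P)"
      define P' where "P' = P - Polynomial.smult c T"
      have "degree P' \<le> degree P"
        unfolding P'_def using T(2) by (intro degree_diff_le) (auto intro: degree_smult_le[THEN le_trans])
      moreover have "coeff P' (degree P) = 0" using T(3) by (simp add: P'_def c_def)
      \<comment> \<open>Zero is split off because \<open>degree 0 = 0\<close>: for a constant
        \<open>P\<close>, possible here when \<open>d = 1\<close>, the degree cannot drop
        further.\<close>
      ultimately have "P' = 0 \<or> degree P' < degree P"
        by (metis le_neq_implies_less leading_coeff_0_iff)
      then have "\<exists>Q\<in>poly_sum_space d. \<exists>R\<in>polys_degree_le (int d - 2). P' = Q + R"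
      proof
        assume "P' = 0"
        then show ?thesis using zero by (intro bexI[of _ 0]) (auto simp: polys_degree_le_def)
      qed (rule less)
      then obtain Q R where "Q \<in> poly_sum_space d" "R \<in> polys_degree_le (int d - 2)" "P' = Q + R"
        by blast
      then show ?thesis
        using add[OF smult[OF T(1)]]
        by (intro bexI[of _ "Polynomial.smult c T + Q"] bexI[of _ R])
          (auto simp: P'_def algebra_simps)
    qed
  qed
qed

lemma complement_poly_sum_space:
  assumes d: "d > 0"
  shows "complement_subspaces class_ring real_poly_space
           (poly_sum_space d) (polys_degree_le (int d - 2))"
proof -
  interpret V: vectorspace class_ring real_poly_space by (rule vectorspace_real_poly_space)
  have "V.submodule_sum (poly_sum_space d) (polys_degree_le (int d - 2)) = carrier real_poly_space"
    using poly_sum_space_plus_low_degree[OF d]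
    unfolding V.submodule_sum_def by (auto simp: real_poly_space_def image_iff Bex_def)
  moreover have "P = 0" if "P \<in> poly_sum_space d" "P \<in> polys_degree_le (int d - 2)" for P
    using degree_poly_sum_space[OF d that(1)] that(2) d
    by (intro ccontr[of "P = 0"]) (auto simp: polys_degree_le_def)
  moreover have "0 \<in> poly_sum_space d" "0 \<in> polys_degree_le (int d - 2)"
    by (auto simp: poly_sum_space_def polys_degree_le_def intro: exI[of _ 0])
  ultimately show ?thesis
    unfolding complement_subspaces_def
    by (intro conjI subspace_poly_sum_space subspace_polys_degree_le)
      (auto simp: real_poly_space_def)
qed

section \<open>Polynomials of bounded degree as coefficient vectors\<close>

text \<open>Identifies the polynomials of degree below \<open>n\<close> with coordinate space, whose
  dimension is already known.\<close>

definition poly_of_coeff_vec :: "'a::comm_monoid_add vec \<Rightarrow> 'a poly" where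
  "poly_of_coeff_vec v = (\<Sum>i<dim_vec v. Polynomial.monom (v $ i) i)"

lemma coeff_poly_of_coeff_vec:
  "coeff (poly_of_coeff_vec v) i = (if i < dim_vec v then v $ i else 0)"
  by (simp add: poly_of_coeff_vec_def coeff_sum coeff_monom if_distrib cong: if_cong)

lemma inj_on_poly_of_coeff_vec: "inj_on poly_of_coeff_vec (carrier_vec n)"
  by (rule inj_onI) (auto simp: poly_eq_iff coeff_poly_of_coeff_vec split: if_splits)

text \<open>For \<open>n = 0\<close> the integer bound is \<open>-1\<close>, and both sides are
  \<open>{0}\<close>.\<close>

lemma poly_of_coeff_vec_image:
  "(poly_of_coeff_vec :: real vec \<Rightarrow> real poly) ` carrier_vec n = polys_degree_le (int n - 1)"
proof (intro subset_antisym subsetI)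
  fix p :: "real poly" assume "p \<in> poly_of_coeff_vec ` carrier_vec n"
  then have "coeff p i = 0" if "i \<ge> n" for i
    using that by (auto simp: coeff_poly_of_coeff_vec)
  then have "p \<noteq> 0 \<longrightarrow> degree p < n" by (metis leading_coeff_0_iff not_le)
  then show "p \<in> polys_degree_le (int n - 1)" by (auto simp: polys_degree_le_def)
next
  fix p assume "p \<in> polys_degree_le (int n - 1)"
  then have "coeff p i = 0" if "i \<ge> n" for i
    using that by (auto simp: polys_degree_le_def intro: coeff_eq_0)
  then have "p = poly_of_coeff_vec (vec n (coeff p))"
    by (auto simp: poly_eq_iff coeff_poly_of_coeff_vec)
  then show "p \<in> poly_of_coeff_vec ` carrier_vec n" by (metis imageI vec_carrier)
qed

lemma linear_map_poly_of_coeff_vec: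
  "linear_map class_ring (module_vec TYPE(real) n) real_poly_space poly_of_coeff_vec"
proof -
  interpret Z: vec_space "TYPE(real)" n .
  interpret V: vectorspace class_ring real_poly_space by (rule vectorspace_real_poly_space)
  have "poly_of_coeff_vec \<in> LinearCombinations.module_hom class_ring (module_vec TYPE(real) n) real_poly_space"
    by (auto simp: LinearCombinations.module_hom_def real_poly_space_def module_vec_def poly_eq_iff
        coeff_poly_of_coeff_vec)
  then show ?thesis
    by (intro linear_mapI Z.vectorspace_axioms V.vectorspace_axioms)
qed

theorem corollary2p3:
  fixes d :: nat
  assumes "d > 0"
  shows "complement_subspaces class_ring real_poly_space
           (poly_sum_space d) (polys_degree_le (int d - 2))
       \<and> has_codimension class_ring real_poly_space (poly_sum_space d) (d - 1)"
proof
  show compl: "complement_subspaces class_ring real_poly_space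
           (poly_sum_space d) (polys_degree_le (int d - 2))"
    using assms by (rule complement_poly_sum_space)
  interpret Z: vec_space "TYPE(real)" "d - 1" .
  \<comment> \<open>Length \<open>d - 1\<close> gives degree at most \<open>d - 2\<close>;
    positivity of \<open>d\<close> makes the natural subtraction agree with the integer one.\<close>
  have "poly_of_coeff_vec ` carrier (module_vec TYPE(real) (d - 1)) = polys_degree_le (int d - 2)"
    using assms by (simp add: poly_of_coeff_vec_image module_vec_def of_nat_diff)
  with compl have "has_codimension class_ring real_poly_space (poly_sum_space d) Z.dim"
    by (intro has_codimension_if_complement_is_image[OF linear_map_poly_of_coeff_vec Z.fin_dim])
      (auto simp: module_vec_def inj_on_poly_of_coeff_vec)
  then show "has_codimension class_ring real_poly_space (poly_sum_space d) (d - 1)"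
    unfolding Z.dim_is_n .
qed

end
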